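(* For any graph $G$ with diameter at least two, $b_{\rm R}(G)\le 2\Delta(G)+\delta(G)-3$.
   Context: Graphs are finite, undirected, without loops or multiple edges; a graph is nonempty if it has at least one edge; $\Delta(G)$ and $\delta(G)$ are the maximum and minimum degree of $G$; the diameter of a graph is the maximum distance between two of its vertices. A Roman dominating function on $G=(V,E)$ is a function $f:V\to\{0,1,2\}$ such that every vertex $x$ with $f(x)=0$ is adjacent to at least one vertex $y$ with $f(y)=2$. Its weight is $\sum_{u\in V}f(u)$. The Roman domination number $\gamma_{\rm R}(G)$ is the minimum weight of a Roman dominating function on $G$. The Roman bondage number of a nonempty graph $G$ is $b_{\rm R}(G)=\min\{|B|: B\subseteq E(G),\ \gamma_{\rm R}(G-B)>\gamma_{\rm R}(G)\}$, with $b_{\rm R}(G)=\infty$ if no such $B$ exists; here $G-B$ is obtained from $G$ by deleting the edges in $B$ (keeping all vertices). *)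

theory Defs
  imports "HOL-Library.Extended_Real"
begin

definition simple_graph :: "'a set \<Rightarrow> 'a set set \<Rightarrow> bool" where
  "simple_graph V E \<longleftrightarrow> finite V \<and> (\<forall>e\<in>E. e \<subseteq> V \<and> card e = 2)"

definition neighbours :: "'a set set \<Rightarrow> 'a \<Rightarrow> 'a set" where
  "neighbours E x = {y. {x, y} \<in> E}"

definition degree :: "'a set set \<Rightarrow> 'a \<Rightarrow> nat" where
  "degree E x = card (neighbours E x)"

definition max_degree :: "'a set \<Rightarrow> 'a set set \<Rightarrow> nat" where
  "max_degree V E = Max (degree E ` V)"

definition min_degree :: "'a set \<Rightarrow> 'a set set \<Rightarrow> nat" where
  "min_degree V E = Min (degree E ` V)"

definition adj_rel :: "'a set set \<Rightarrow> 'a rel" where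
  "adj_rel E = {(x, y). {x, y} \<in> E}"

text \<open>The distance is the least length of a walk, and is infinite if there is no walk.\<close>

definition graph_dist :: "'a set set \<Rightarrow> 'a \<Rightarrow> 'a \<Rightarrow> enat" where
  "graph_dist E x y = (INF n \<in> {n. (x, y) \<in> adj_rel E ^^ n}. enat n)"

definition graph_diameter :: "'a set \<Rightarrow> 'a set set \<Rightarrow> enat" where
  "graph_diameter V E = (SUP x \<in> V. SUP y \<in> V. graph_dist E x y)"

definition connected_graph :: "'a set \<Rightarrow> 'a set set \<Rightarrow> bool" where
  "connected_graph V E \<longleftrightarrow> V \<noteq> {} \<and> (\<forall>x\<in>V. \<forall>y\<in>V. (x, y) \<in> (adj_rel E)\<^sup>*)"

definition roman_dominating :: "'a set \<Rightarrow> 'a set set \<Rightarrow> ('a \<Rightarrow> nat) \<Rightarrow> bool" where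
  "roman_dominating V E f \<longleftrightarrow>
     (\<forall>x\<in>V. f x \<in> {0, 1, 2}) \<and>
     (\<forall>x\<in>V. f x = 0 \<longrightarrow> (\<exists>y\<in>V. y \<in> neighbours E x \<and> f y = 2))"

definition roman_domination_number :: "'a set \<Rightarrow> 'a set set \<Rightarrow> nat" where
  "roman_domination_number V E = (INF f \<in> {f. roman_dominating V E f}. \<Sum>u\<in>V. f u)"

text \<open>In \<^typ>\<open>enat\<close> the infimum of the empty set is \<open>\<infinity>\<close>, which covers the case that
  deleting edges never increases the Roman domination number.\<close>

definition roman_bondage_number :: "'a set \<Rightarrow> 'a set set \<Rightarrow> enat" where
  "roman_bondage_number V E =
     (INF B \<in> {B. B \<subseteq> E \<and> roman_domination_number V (E - B) > roman_domination_number V E}.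
        enat (card B))"

end

theory Submission
  imports Defs
begin

text \<open>
  The bound comes from a path \<open>x y z\<close> on three vertices.  Delete every edge that meets the path,
  except \<open>{y, z}\<close>.  Afterwards \<open>x\<close> is isolated and \<open>{y, z}\<close> is a component of its own, so every
  Roman dominating function spends at least \<open>1 + 2 = 3\<close> on the path, and the remaining vertices are
  dominated among themselves.  In the original graph the value \<open>2\<close> at \<open>y\<close> dominates the whole
  path, so the weight can be lowered by one.  Hence the deletion raises the Roman domination
  number (\<open>roman_domination_number_less_if_path_isolated\<close>).  The number of deleted edges is at most
  the degree sum of the path minus three: in that sum the edge \<open>{x, y}\<close> is counted once too often,
  and the edge \<open>{y, z}\<close>, which is kept, is counted twice (\<open>roman_bondage_number_path_bound\<close>).

  In a connected graph of diameter at least two, every vertex lies on such a path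
  (\<open>vertex_on_path\<close>).  Applied to a vertex of minimum degree, this makes the degree sum at most
  \<open>2 * \<Delta> + \<delta>\<close>.
\<close>

definition incident_edges :: "'a set set \<Rightarrow> 'a \<Rightarrow> 'a set set" where
  "incident_edges E x = {e \<in> E. x \<in> e}"

lemma simple_graph_edgeD:
  assumes "simple_graph V E" "{x, y} \<in> E"
  shows "x \<in> V" "y \<in> V" "x \<noteq> y"
  using assms unfolding simple_graph_def by (force, force, force)

lemma incident_edges_eq_image:
  assumes "simple_graph V E"
  shows "incident_edges E x = (\<lambda>y. {x, y}) ` neighbours E x"
proof
  show "incident_edges E x \<subseteq> (\<lambda>y. {x, y}) ` neighbours E x"
  proof
    fix e assume "e \<in> incident_edges E x"
    then have e: "e \<in> E" "x \<in> e" by (auto simp: incident_edges_def)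
    then have "card e = 2" using assms by (auto simp: simple_graph_def)
    then obtain y where "e = {x, y}" using e(2) by (auto simp: card_2_iff)
    then show "e \<in> (\<lambda>y. {x, y}) ` neighbours E x" using e(1) by (auto simp: neighbours_def)
  qed
qed (auto simp: incident_edges_def neighbours_def)

lemma card_incident_edges:
  assumes "simple_graph V E"
  shows "card (incident_edges E x) = degree E x"
  unfolding incident_edges_eq_image[OF assms] degree_def
  by (rule card_image) (auto simp: inj_on_def doubleton_eq_iff)

lemma finite_incident_edges:
  assumes "simple_graph V E"
  shows "finite (incident_edges E x)"
proof (rule finite_subset)
  show "incident_edges E x \<subseteq> Pow V"
    using assms by (auto simp: simple_graph_def incident_edges_def)
  show "finite (Pow V)" using assms by (simp add: simple_graph_def)
qed

lemma roman_domination_number_le: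
  assumes "roman_dominating V E f"
  shows "roman_domination_number V E \<le> (\<Sum>u\<in>V. f u)"
  unfolding roman_domination_number_def
  by (rule cINF_lower) (use assms in auto)

lemma roman_domination_number_attained:
  obtains f where "roman_dominating V E f" "roman_domination_number V E = (\<Sum>u\<in>V. f u)"
proof -
  have "roman_dominating V E (\<lambda>_. 1)" by (simp add: roman_dominating_def)
  then have "(\<lambda>f. \<Sum>u\<in>V. f u) ` {f. roman_dominating V E f} \<noteq> {}" by blast
  from Inf_nat_def1[OF this] show ?thesis
    using that by (auto simp: roman_domination_number_def)
qed

text \<open>
  An optimal function for the smaller graph \<open>F\<close> gives \<open>x\<close> at least \<open>1\<close> and \<open>y\<close>, \<open>z\<close> together at
  least \<open>2\<close>.  Moving the weight of the path to \<open>y\<close>, as the value \<open>2\<close>, saves at least one.  Outside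
  the path nothing is lost, because in \<open>F\<close> no outside vertex is adjacent to the path.
\<close>

lemma roman_domination_number_less_if_path_isolated:
  assumes G: "simple_graph V E" and xy: "{x, y} \<in> E" and yz: "{y, z} \<in> E" and "x \<noteq> z"
    and F: "F = E - (incident_edges E x \<union> incident_edges E y \<union> incident_edges E z - {{y, z}})"
  shows "roman_domination_number V E < roman_domination_number V F"
proof -
  have V: "x \<in> V" "y \<in> V" "z \<in> V" and ne: "x \<noteq> y" "y \<noteq> z" "x \<noteq> z"
    using simple_graph_edgeD[OF G xy] simple_graph_edgeD[OF G yz] \<open>x \<noteq> z\<close> by auto
  have fin: "finite V" using G by (simp add: simple_graph_def)
  obtain f where f: "roman_dominating V F f"
    and wf: "roman_domination_number V F = (\<Sum>u\<in>V. f u)"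
    by (rule roman_domination_number_attained)
  have nx: "neighbours F x = {}"
    using ne by (auto simp: F neighbours_def incident_edges_def doubleton_eq_iff)
  have ny: "neighbours F y \<subseteq> {z}" and nz: "neighbours F z \<subseteq> {y}"
    using ne by (auto simp: F neighbours_def incident_edges_def doubleton_eq_iff)
  have outside: "neighbours F v \<subseteq> neighbours E v - {x, y, z}" if "v \<notin> {x, y, z}" for v
    using that by (auto simp: F neighbours_def incident_edges_def doubleton_eq_iff)
  have dom: "f v \<in> {0, 1, 2}" "f v = 0 \<Longrightarrow> \<exists>w\<in>V. w \<in> neighbours F v \<and> f w = 2" if "v \<in> V" for v
    using f that by (auto simp: roman_dominating_def)
  have fx: "f x \<ge> 1"
    using dom(2)[OF V(1)] nx by (cases "f x = 0") auto
  have fyz: "f y + f z \<ge> 2"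
  proof -
    have "f z = 2" if "f y = 0" using dom(2)[OF V(2) that] ny by auto
    moreover have "f y = 2" if "f z = 0" using dom(2)[OF V(3) that] nz by auto
    ultimately show ?thesis by (cases "f y = 0"; cases "f z = 0") auto
  qed
  define g where "g = f(x := 0, y := 2, z := 0)"
  have "roman_dominating V E g"
    unfolding roman_dominating_def
  proof (intro conjI ballI impI)
    fix v assume v: "v \<in> V"
    show "g v \<in> {0, 1, 2}" using dom(1)[OF v] by (simp add: g_def)
    assume gv: "g v = 0"
    show "\<exists>w\<in>V. w \<in> neighbours E v \<and> g w = 2"
    proof (cases "v \<in> {x, y, z}")
      case True
      then have "v = x \<or> v = z" using gv ne by (auto simp: g_def)
      then have "y \<in> neighbours E v"
        using xy yz by (auto simp: neighbours_def insert_commute)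
      then show ?thesis using V(2) ne by (auto simp: g_def)
    next
      case False
      then have "f v = 0" using gv by (simp add: g_def)
      then obtain w where w: "w \<in> V" "w \<in> neighbours F v" "f w = 2" using dom(2)[OF v] by blast
      with outside[OF False] have "w \<in> neighbours E v" "w \<notin> {x, y, z}" by auto
      then show ?thesis using w by (auto simp: g_def)
    qed
  qed
  then have "roman_domination_number V E \<le> (\<Sum>u\<in>V. g u)"
    by (rule roman_domination_number_le)
  also have "\<dots> < (\<Sum>u\<in>V. f u)"
  proof -
    have split: "sum h V = h x + h y + h z + sum h (V - {x, y, z})" for h :: "'a \<Rightarrow> nat"
    proof -
      have "sum h V = sum h (V - {x, y, z}) + sum h {x, y, z}"
        by (rule sum.subset_diff) (use V fin in auto)
      then show ?thesis using ne by simp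
    qed
    have "sum g (V - {x, y, z}) = sum f (V - {x, y, z})"
      by (rule sum.cong) (auto simp: g_def)
    moreover have "g x + g y + g z = 2" using ne by (simp add: g_def)
    ultimately show ?thesis using split[of g] split[of f] fx fyz by linarith
  qed
  finally show ?thesis using wf by simp
qed

text \<open>
  Charge the edge \<open>{x, y}\<close> to \<open>x\<close> only.  Then \<open>y\<close> is charged neither for \<open>{x, y}\<close> nor for the kept
  edge \<open>{y, z}\<close>, and \<open>z\<close> is not charged for \<open>{y, z}\<close>; this saves three.
\<close>

lemma roman_bondage_number_path_bound:
  assumes G: "simple_graph V E" and xy: "{x, y} \<in> E" and yz: "{y, z} \<in> E" and "x \<noteq> z"
  shows "roman_bondage_number V E + 3 \<le> enat (degree E x + degree E y + degree E z)"
proof -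
  define B where "B = incident_edges E x \<union> incident_edges E y \<union> incident_edges E z - {{y, z}}"
  have ne: "x \<noteq> y" "y \<noteq> z"
    using simple_graph_edgeD[OF G xy] simple_graph_edgeD[OF G yz] by auto
  have "B \<subseteq> E" by (auto simp: B_def incident_edges_def)
  moreover have "roman_domination_number V E < roman_domination_number V (E - B)"
    by (rule roman_domination_number_less_if_path_isolated[OF assms]) (simp add: B_def)
  ultimately have le: "roman_bondage_number V E \<le> enat (card B)"
    unfolding roman_bondage_number_def by (intro INF_lower) simp
  have inc: "{x, y} \<in> incident_edges E x" "{x, y} \<in> incident_edges E y"
    "{y, z} \<in> incident_edges E y" "{y, z} \<in> incident_edges E z" "{y, z} \<notin> incident_edges E x"
    using xy yz ne \<open>x \<noteq> z\<close> by (auto simp: incident_edges_def)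
  have fin: "finite (incident_edges E v)" for v
    by (rule finite_incident_edges[OF G])
  let ?Y = "incident_edges E y - {{x, y}, {y, z}}" and ?Z = "incident_edges E z - {{y, z}}"
  have B_eq: "B = incident_edges E x \<union> ?Y \<union> ?Z"
    using inc by (auto simp: B_def)
  have "card B \<le> card (incident_edges E x) + card ?Y + card ?Z"
    unfolding B_eq
    using card_Un_le[of "incident_edges E x \<union> ?Y" ?Z] card_Un_le[of "incident_edges E x" ?Y]
    by linarith
  moreover have "card ?Y + 2 = degree E y"
  proof -
    have "{x, y} \<noteq> {y, z}" using \<open>x \<noteq> z\<close> by (auto simp: doubleton_eq_iff)
    then have two: "card {{x, y}, {y, z}} = 2" by simp
    have sub: "{{x, y}, {y, z}} \<subseteq> incident_edges E y" using inc by simp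
    from card_mono[OF fin sub] card_Diff_subset[OF _ sub] two show ?thesis
      using card_incident_edges[OF G, of y] by simp
  qed
  moreover have "card ?Z + 1 = degree E z"
    using card.remove[OF fin inc(4)] card_incident_edges[OF G, of z] by simp
  ultimately have "card B + 3 \<le> degree E x + degree E y + degree E z"
    using card_incident_edges[OF G, of x] by linarith
  moreover have "roman_bondage_number V E + 3 \<le> enat (card B + 3)"
    using add_right_mono[OF le, of 3] by (simp add: numeral_eq_enat)
  ultimately show ?thesis by (meson enat_ord_simps(1) order_trans)
qed

lemma rtrancl_leaves_set:
  assumes "(a, b) \<in> r\<^sup>*" "a \<in> C" "b \<notin> C"
  shows "\<exists>s t. (s, t) \<in> r \<and> s \<in> C \<and> t \<notin> C"
  using assms by (induction rule: rtrancl_induct) blast+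

lemma non_adjacent_pair_if_diameter_ge_2:
  assumes "graph_diameter V E \<ge> 2"
  shows "\<exists>a\<in>V. \<exists>b\<in>V. a \<noteq> b \<and> {a, b} \<notin> E"
proof (rule ccontr)
  assume none: "\<not> ?thesis"
  have adj: "a = b \<or> {a, b} \<in> E" if "a \<in> V" "b \<in> V" for a b
    using none that by blast
  have "graph_dist E a b \<le> 1" if "a \<in> V" "b \<in> V" for a b
  proof -
    have walk: "graph_dist E a b \<le> enat n" if "(a, b) \<in> adj_rel E ^^ n" for n
      unfolding graph_dist_def by (rule INF_lower) (use that in simp)
    from adj[OF that] show ?thesis
    proof
      assume "a = b"
      then have "graph_dist E a b \<le> enat 0" by (intro walk) simp
      also have "\<dots> \<le> 1" by (simp add: one_enat_def)
      finally show ?thesis .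
    next
      assume "{a, b} \<in> E"
      then have "graph_dist E a b \<le> enat 1" by (intro walk) (simp add: adj_rel_def)
      then show ?thesis by (simp add: one_enat_def)
    qed
  qed
  then have "graph_diameter V E \<le> 1"
    unfolding graph_diameter_def by (intro SUP_least)
  then have "(2::enat) \<le> 1" using assms by (rule order_trans[rotated])
  then show False by (simp add: numeral_eq_enat one_enat_def)
qed

text \<open>
  If \<open>u\<close> is adjacent to all other vertices, then \<open>u\<close> is the middle of a path between two
  non-adjacent vertices.  Otherwise some edge \<open>{s, t}\<close> leaves the closed neighbourhood of \<open>u\<close>, and
  \<open>u s t\<close> is a path.
\<close>

lemma vertex_on_path:
  assumes "connected_graph V E" and "graph_diameter V E \<ge> 2" and u: "u \<in> V"
  obtains x y z where "{x, y} \<in> E" "{y, z} \<in> E" "x \<noteq> z" "u \<in> {x, y, z}"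
proof (cases "V \<subseteq> insert u (neighbours E u)")
  case True
  obtain a b where ab: "a \<in> V" "b \<in> V" "a \<noteq> b" "{a, b} \<notin> E"
    using non_adjacent_pair_if_diameter_ge_2[OF assms(2)] by blast
  then have "a \<noteq> u" "b \<noteq> u"
    using True by (auto simp: neighbours_def insert_commute)
  then have "{a, u} \<in> E" "{u, b} \<in> E"
    using True ab by (auto simp: neighbours_def insert_commute)
  then show ?thesis using that ab(3) by blast
next
  case False
  then obtain w where w: "w \<in> V" "w \<notin> insert u (neighbours E u)" by blast
  have "(u, w) \<in> (adj_rel E)\<^sup>*"
    using assms(1) u w(1) by (simp add: connected_graph_def)
  then obtain s t where st: "(s, t) \<in> adj_rel E"
      "s \<in> insert u (neighbours E u)" "t \<notin> insert u (neighbours E u)"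
    using w(2) rtrancl_leaves_set[of u w "adj_rel E" "insert u (neighbours E u)"] by blast
  then have "{s, t} \<in> E" "{u, s} \<in> E" "u \<noteq> t"
    by (auto simp: adj_rel_def neighbours_def)
  then show ?thesis using that by blast
qed

theorem corollary5p2:
  fixes V :: "'a set" and E :: "'a set set"
  assumes "simple_graph V E"
    and "connected_graph V E"
    and "graph_diameter V E \<ge> 2"
  shows "ereal_of_enat (roman_bondage_number V E)
    \<le> ereal (2 * real (max_degree V E) + real (min_degree V E) - 3)"
proof -
  have fin: "finite V" and "V \<noteq> {}"
    using assms(1,2) by (auto simp: simple_graph_def connected_graph_def)
  then have "min_degree V E \<in> degree E ` V"
    unfolding min_degree_def by (intro Min_in) auto
  then obtain u where u: "u \<in> V" "degree E u = min_degree V E" by force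
  obtain x y z where p: "{x, y} \<in> E" "{y, z} \<in> E" "x \<noteq> z" "u \<in> {x, y, z}"
    using vertex_on_path[OF assms(2,3) u(1)] .
  have max: "degree E v \<le> max_degree V E" if "v \<in> V" for v
    unfolding max_degree_def using fin that by (intro Max_ge) auto
  have "degree E x + degree E y + degree E z \<le> 2 * max_degree V E + min_degree V E"
    using max[of x] max[of y] max[of z] p(4) u(2)
      simple_graph_edgeD[OF assms(1) p(1)] simple_graph_edgeD[OF assms(1) p(2)] by auto
  then have le: "roman_bondage_number V E + 3 \<le> enat (2 * max_degree V E + min_degree V E)"
    using roman_bondage_number_path_bound[OF assms(1) p(1-3)]
    by (meson enat_ord_simps(1) order_trans)
  then obtain b where b: "roman_bondage_number V E = enat b"
    by (cases "roman_bondage_number V E") auto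
  with le have "b + 3 \<le> 2 * max_degree V E + min_degree V E"
    by (simp add: numeral_eq_enat)
  then have "real b + 3 \<le> 2 * real (max_degree V E) + real (min_degree V E)"
    by linarith
  then show ?thesis using b by simp
qed

end
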